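(* Let $S$ be a subspace of $H$ of finite dimension $r\ge1$ with a fixed orthonormal basis $\{s^l\}_{l=1}^r$. Let $U:M_r(\mathbb{C})\to\mathcal{B}_S$ be the bijective linear operator determined by $U(W^{k,j})=V^{k,j}$ for every $(k,j)\in J$ and $U(I_r)=P_S$. Then, for every $A,B\in M_r(\mathbb{C})$: (1) $\operatorname{tr}(U(A))=\operatorname{tr}(A)$. (2) $(U(A))^*=U(A^* )$. (3) $(U(A))^*=U(A)$ if and only if $A=A^*$. (4) $U(AB)=U(A)U(B)$ and $U^{-1}(U(A)U(B))=AB$. (5) If $A$ is invertible, then $U(A)$ is invertible in the algebra $\mathcal{B}_S$ and $U(A^{-1})U(A)=P_S$. (6) $A\ge0$ if and only if $U(A)\ge0$. (7) $\operatorname{tr}(U(A)(U(B))^* )=\operatorname{tr}(AB^* )$ (that is, $U$ is unitary for the trace inner products). (8) $P\in M_r(\mathbb{C})$ is a projection if and only if $U(P)$ is a projection. (9) $U(\{R\in M_r^h(\mathbb{C}):R\ge0,\ \operatorname{tr}(R)=1\})=\mathcal{D}_S$.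
   Context: $H$ is a complex separable infinite dimensional Hilbert space, $P_S$ is the orthogonal projection onto $S$, $\mathcal{B}_S=P_SB(H)P_S$ (an algebra with unit $P_S$), $\mathcal{B}_1(H)$ is the space of trace-class operators, $\mathcal{D}_S=\{Y\in\mathcal{B}_1(H):P_SY=Y\ge0,\ \operatorname{tr}(Y)=1\}$, and $M_r^h(\mathbb{C})$ is the set of hermitian $r\times r$ matrices. Let $J=\{(k,j):1\le k,j\le r\}\setminus\{(r,r)\}$. With $e_1,\dots,e_r$ the canonical basis of $\mathbb{R}^r$ and $e_k\otimes e_j=e_ke_j^t\in M_r(\mathbb{C})$, define $W^{j,j}=\frac{1}{\sqrt{1+1/j}}\Big(\sum_{l=1}^j\frac1j\,e_l\otimes e_l-e_{j+1}\otimes e_{j+1}\Big)$ for $j=1,\dots,r-1$; $W^{k,j}=\frac1{\sqrt2}(e_k\otimes e_j+e_j\otimes e_k)$ for $k<j$; $W^{k,j}=\frac{i}{\sqrt2}(e_k\otimes e_j-e_j\otimes e_k)$ for $j<k$. With $(s^k\otimes s^j)(x)=\langle x,s^j\rangle s^k$, define $V^{j,j}=\frac{1}{\sqrt{1+1/j}}\Big(\sum_{l=1}^j\frac1j\,s^l\otimes s^l-s^{j+1}\otimes s^{j+1}\Big)$ for $j=1,\dots,r-1$; $V^{k,j}=\frac1{\sqrt2}(s^k\otimes s^j+s^j\otimes s^k)$ for $k<j$; $V^{k,j}=\frac{i}{\sqrt2}(s^k\otimes s^j-s^j\otimes s^k)$ for $j<k$. The set $\{W^{k,j}\}_{(k,j)\in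 J}\cup\{I_r\}$ is a basis of $M_r(\mathbb{C})$ and $\{V^{k,j}\}_{(k,j)\in J}\cup\{P_S\}$ is a basis of $\mathcal{B}_S$. *)

theory Defs
  imports
    "HOL-Analysis.Analysis"
    "Jordan_Normal_Form.Schur_Decomposition"
begin

section \<open>Complex Hilbert spaces\<close>

text \<open>The inner product is linear in the first argument.  The real scalar multiplication of the
  underlying real normed space is the restriction of the complex one.\<close>

class complex_inner = real_normed_vector +
  fixes cscale :: "complex \<Rightarrow> 'a \<Rightarrow> 'a"  (infixr \<open>*\<^sub>C\<close> 75)
    and cinner :: "'a \<Rightarrow> 'a \<Rightarrow> complex"
  assumes cscale_add_right: "c *\<^sub>C (x + y) = c *\<^sub>C x + c *\<^sub>C y"
    and cscale_add_left: "(c + d) *\<^sub>C x = c *\<^sub>C x + d *\<^sub>C x"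
    and cscale_cscale: "c *\<^sub>C d *\<^sub>C x = (c * d) *\<^sub>C x"
    and cscale_one: "1 *\<^sub>C x = x"
    and scaleR_cscale: "scaleR a x = complex_of_real a *\<^sub>C x"
    and cinner_commute: "cinner x y = cnj (cinner y x)"
    and cinner_add_left: "cinner (x + y) z = cinner x z + cinner y z"
    and cinner_cscale_left: "cinner (c *\<^sub>C x) y = c * cinner x y"
    and cinner_self_nonneg: "cinner x x \<in> \<real>\<^sub>\<ge>\<^sub>0"
    and cinner_eq_zero_iff: "cinner x x = 0 \<longleftrightarrow> x = 0"
    and norm_eq_sqrt_cinner: "norm x = sqrt (Re (cinner x x))"

class complex_hilbert = complex_inner + complete_space

interpretation complex_vector: vector_space "cscale :: complex \<Rightarrow> 'a \<Rightarrow> 'a::complex_inner"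
  by unfold_locales
    (simp_all add: cscale_add_right cscale_add_left cscale_cscale cscale_one)

definition orthonormal_set :: "'a::complex_inner set \<Rightarrow> bool" where
  "orthonormal_set B \<longleftrightarrow> (\<forall>e\<in>B. \<forall>f\<in>B. cinner e f = (if e = f then 1 else 0))"

definition hilbert_basis :: "'a::complex_inner set \<Rightarrow> bool" where
  "hilbert_basis B \<longleftrightarrow> orthonormal_set B \<and> closure (complex_vector.span B) = UNIV"

section \<open>Operators\<close>

definition bounded_ops :: "('a::complex_inner \<Rightarrow> 'a) set" where
  "bounded_ops = {T. Vector_Spaces.linear cscale cscale T \<and> bounded_linear T}"

definition op_adjoint :: "('a::complex_inner \<Rightarrow> 'a) \<Rightarrow> 'a \<Rightarrow> 'a" where
  "op_adjoint T = (THE T'. \<forall>x y. cinner (T x) y = cinner x (T' y))"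

definition op_nonneg :: "('a::complex_inner \<Rightarrow> 'a) \<Rightarrow> bool" where
  "op_nonneg T \<longleftrightarrow> (\<forall>x. cinner (T x) x \<in> \<real>\<^sub>\<ge>\<^sub>0)"

text \<open>Projections are orthogonal projections, i.e. self-adjoint idempotents.\<close>

definition op_projection :: "('a::complex_inner \<Rightarrow> 'a) \<Rightarrow> bool" where
  "op_projection T \<longleftrightarrow> T \<in> bounded_ops \<and> T \<circ> T = T \<and> op_adjoint T = T"

text \<open>The operator \<open>T\<close> below is the modulus of \<open>Y\<close>, the positive square root of \<open>Y\<^sup>*Y\<close>.\<close>

definition trace_class :: "('a::complex_inner \<Rightarrow> 'a) set" where
  "trace_class = {Y \<in> bounded_ops. \<exists>T\<in>bounded_ops. op_nonneg T \<and> T \<circ> T = op_adjoint Y \<circ> Y \<and>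
     (\<exists>B. hilbert_basis B \<and> (\<lambda>e. cinner (T e) e) summable_on B)}"

text \<open>For trace-class operators the value does not depend on the chosen orthonormal basis.\<close>

definition op_trace :: "('a::complex_inner \<Rightarrow> 'a) \<Rightarrow> complex" where
  "op_trace Y = (\<Sum>\<^sub>\<infinity>e\<in>(SOME B. hilbert_basis B). cinner (Y e) e)"

definition orth_proj :: "'a::complex_inner set \<Rightarrow> 'a \<Rightarrow> 'a" where
  "orth_proj S x = (THE y. y \<in> S \<and> (\<forall>z\<in>S. cinner (x - y) z = 0))"

definition corner_algebra :: "'a::complex_inner set \<Rightarrow> ('a \<Rightarrow> 'a) set" where
  "corner_algebra S = {orth_proj S \<circ> T \<circ> orth_proj S | T. T \<in> bounded_ops}"

definition density_ops :: "'a::complex_inner set \<Rightarrow> ('a \<Rightarrow> 'a) set" where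
  "density_ops S = {Y \<in> trace_class. orth_proj S \<circ> Y = Y \<and> op_nonneg Y \<and> op_trace Y = 1}"

definition rank_one :: "'a::complex_inner \<Rightarrow> 'a \<Rightarrow> 'a \<Rightarrow> 'a" where
  "rank_one u v x = cinner x v *\<^sub>C u"

section \<open>Matrices\<close>

definition mat_trace :: "complex mat \<Rightarrow> complex" where
  "mat_trace A = (\<Sum>i<dim_row A. A $$ (i, i))"

definition mat_nonneg :: "complex mat \<Rightarrow> bool" where
  "mat_nonneg A \<longleftrightarrow> (\<forall>v\<in>carrier_vec (dim_row A). (A *\<^sub>v v) \<bullet>c v \<in> \<real>\<^sub>\<ge>\<^sub>0)"

definition mat_hermitian :: "complex mat \<Rightarrow> bool" where
  "mat_hermitian A \<longleftrightarrow> mat_adjoint A = A"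

definition mat_projection :: "complex mat \<Rightarrow> bool" where
  "mat_projection A \<longleftrightarrow> A * A = A \<and> mat_adjoint A = A"

section \<open>The two bases\<close>

text \<open>The indices \<open>k\<close>, \<open>j\<close>, \<open>l\<close> run from \<open>1\<close> to \<open>r\<close>, whereas the entries of a matrix are numbered
  from \<open>0\<close>.\<close>

definition J_index :: "nat \<Rightarrow> (nat \<times> nat) set" where
  "J_index r = {1..r} \<times> {1..r} - {(r, r)}"

definition E_mat :: "nat \<Rightarrow> nat \<Rightarrow> nat \<Rightarrow> complex mat" where
  "E_mat r k j = mat r r (\<lambda>(a, b). if a = k - 1 \<and> b = j - 1 then 1 else 0)"

text \<open>In the diagonal case the inner \<open>mat\<close> is the entrywise form of a sum of matrices: the type
  of matrices of arbitrary size has no zero, so \<open>sum\<close> does not apply to it directly.\<close>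

definition W_mat :: "nat \<Rightarrow> nat \<Rightarrow> nat \<Rightarrow> complex mat" where
  "W_mat r k j =
    (if k = j then
       complex_of_real (1 / sqrt (1 + 1 / real j)) \<cdot>\<^sub>m
         (mat r r (\<lambda>ab. \<Sum>l=1..j. (complex_of_real (1 / real j) \<cdot>\<^sub>m E_mat r l l) $$ ab)
            - E_mat r (j + 1) (j + 1))
     else if k < j then
       complex_of_real (1 / sqrt 2) \<cdot>\<^sub>m (E_mat r k j + E_mat r j k)
     else
       (\<i> / complex_of_real (sqrt 2)) \<cdot>\<^sub>m (E_mat r k j - E_mat r j k))"

definition V_op :: "(nat \<Rightarrow> 'a::complex_inner) \<Rightarrow> nat \<Rightarrow> nat \<Rightarrow> 'a \<Rightarrow> 'a" where
  "V_op s k j = (\<lambda>x.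
    if k = j then
      complex_of_real (1 / sqrt (1 + 1 / real j)) *\<^sub>C
        ((\<Sum>l=1..j. complex_of_real (1 / real j) *\<^sub>C rank_one (s l) (s l) x)
           - rank_one (s (j + 1)) (s (j + 1)) x)
    else if k < j then
      complex_of_real (1 / sqrt 2) *\<^sub>C (rank_one (s k) (s j) x + rank_one (s j) (s k) x)
    else
      (\<i> / complex_of_real (sqrt 2)) *\<^sub>C (rank_one (s k) (s j) x - rank_one (s j) (s k) x))"

end

theory Submission
  imports Defs
begin

text \<open>Let \<open>T\<close> be the isometry from \<open>\<complex>\<^sup>r\<close> into \<open>H\<close> that sends the canonical basis to
  \<open>s\<^sup>1, \<dots>, s\<^sup>r\<close>.  Its adjoint reads off coordinates, \<open>T\<^sup>*T\<close> is the identity matrix and \<open>TT\<^sup>*\<close> is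
  the projection onto \<open>S\<close>.  The map \<open>A \<mapsto> T A T\<^sup>*\<close> (\<open>op_of_mat\<close>) sends the matrix unit \<open>e\<^sub>k \<otimes> e\<^sub>j\<close>
  to \<open>s\<^sup>k \<otimes> s\<^sup>j\<close>.  Hence it sends each \<open>W\<close> to the corresponding \<open>V\<close> and the identity matrix to
  \<open>P\<^sub>S\<close>.  Since the matrices \<open>W\<close> together with the identity span all matrices
  (\<open>linear_vanishes_if_vanishes_on_W\<close>), \<open>U A = T A T\<^sup>*\<close> for every \<open>A\<close>.

  The algebraic statements follow from this formula: \<open>T A T\<^sup>* T B T\<^sup>* = T A B T\<^sup>*\<close>, the adjoint of
  \<open>T A T\<^sup>*\<close> is \<open>T A\<^sup>* T\<^sup>*\<close>, and the quadratic form of \<open>T A T\<^sup>*\<close> at \<open>x\<close> is that of \<open>A\<close> at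
  \<open>T\<^sup>*x\<close>, where \<open>T\<^sup>*x\<close> runs through all of \<open>\<complex>\<^sup>r\<close>.  The statement on inverses is
  multiplicativity, and those on self-adjointness and projections use the injectivity of \<open>U\<close>.

  The trace in \<open>H\<close> is an infinite sum over an unspecified orthonormal basis.  Separability
  provides a basis (\<open>hilbert_basis_exists\<close>), and Parseval's identity evaluates the trace of
  \<open>s\<^sup>k \<otimes> s\<^sup>j\<close> as \<open>\<langle>s\<^sup>k, s\<^sup>j\<rangle>\<close> in any basis, so the trace of \<open>T A T\<^sup>*\<close> is that of \<open>A\<close>.

  For the density operators, \<open>Y \<ge> 0\<close> is self-adjoint, so \<open>P\<^sub>S Y = Y\<close> gives
  \<open>Y = P\<^sub>S Y P\<^sub>S\<close>. Thus \<open>Y\<close> lies in the corner algebra, hence in the range of \<open>U\<close>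
  (\<open>op_nonneg_in_corner_algebra\<close>).  Conversely, \<open>U R\<close> with \<open>R \<ge> 0\<close> is its own modulus, and its
  diagonal sum converges by Parseval, so it is of trace class.\<close>

section \<open>Inner product spaces\<close>

lemma cinner_add_right: "cinner x (y + z) = cinner x y + cinner x z"
  by (metis cinner_add_left cinner_commute complex_cnj_add)

lemma cinner_cscale_right: "cinner x (c *\<^sub>C y) = cnj c * cinner x y"
  by (metis cinner_cscale_left cinner_commute complex_cnj_mult)

lemma cinner_zero_left [simp]: "cinner 0 x = 0"
  using cinner_add_left[of 0 0 x] by simp

lemma cinner_zero_right [simp]: "cinner x 0 = 0"
  using cinner_add_right[of x 0 0] by simp

lemma cinner_minus_left: "cinner (- x) y = - cinner x y"
  using cinner_add_left[of x "- x" y] by (simp add: add_eq_0_iff)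

lemma cinner_minus_right: "cinner x (- y) = - cinner x y"
  using cinner_add_right[of x y "- y"] by (simp add: add_eq_0_iff)

lemma cinner_diff_left: "cinner (x - y) z = cinner x z - cinner y z"
  using cinner_add_left[of x "- y" z] by (simp add: cinner_minus_left)

lemma cinner_diff_right: "cinner x (y - z) = cinner x y - cinner x z"
  using cinner_add_right[of x y "- z"] by (simp add: cinner_minus_right)

lemma cinner_sum_left: "cinner (sum f A) y = (\<Sum>i\<in>A. cinner (f i) y)"
  by (induction A rule: infinite_finite_induct) (simp_all add: cinner_add_left)

lemma cinner_sum_right: "cinner x (sum f A) = (\<Sum>i\<in>A. cinner x (f i))"
  by (induction A rule: infinite_finite_induct) (simp_all add: cinner_add_right)

lemma cinner_eqI_right:
  assumes "\<And>x. cinner x y = cinner x z"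
  shows "y = z"
  using assms[of "y - z"] cinner_eq_zero_iff[of "y - z"] by (simp add: cinner_diff_right)

lemma cinner_eqI_left:
  assumes "\<And>y. cinner x y = cinner z y"
  shows "x = z"
  using assms[of "x - z"] cinner_eq_zero_iff[of "x - z"] by (simp add: cinner_diff_left)

lemma cinner_self: "cinner x x = complex_of_real ((norm x)\<^sup>2)"
  using cinner_self_nonneg[of x]
  by (auto simp: norm_eq_sqrt_cinner complex_nonneg_Reals_iff complex_eq_iff)

lemma norm_cscale: "norm (c *\<^sub>C x) = cmod c * norm x"
proof -
  have "complex_of_real ((norm (c *\<^sub>C x))\<^sup>2) = (c * cnj c) * cinner x x"
    by (simp add: cinner_self[symmetric] cinner_cscale_left cinner_cscale_right del: of_real_power)
  also have "\<dots> = complex_of_real ((cmod c * norm x)\<^sup>2)"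
    by (simp add: cinner_self complex_norm_square[symmetric] power_mult_distrib)
  finally have "(norm (c *\<^sub>C x))\<^sup>2 = (cmod c * norm x)\<^sup>2"
    using of_real_eq_iff by blast
  then show ?thesis
    by (simp add: power2_eq_iff_nonneg)
qed

lemma norm_add_orthogonal:
  assumes "cinner x y = 0"
  shows "(norm (x + y))\<^sup>2 = (norm x)\<^sup>2 + (norm y)\<^sup>2"
proof -
  have "cinner y x = 0"
    using assms by (metis cinner_commute complex_cnj_zero)
  then have "complex_of_real ((norm (x + y))\<^sup>2) = complex_of_real ((norm x)\<^sup>2 + (norm y)\<^sup>2)"
    using assms unfolding cinner_self[symmetric] of_real_add
    by (simp add: cinner_add_left cinner_add_right)
  then show ?thesis
    using of_real_eq_iff by blast
qed

text \<open>This is Pythagoras for the decomposition of \<open>x\<close> into its component along \<open>y\<close> and the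
  remainder.\<close>

lemma Cauchy_Schwarz_cinner: "cmod (cinner x y) \<le> norm x * norm y"
proof (cases "y = 0")
  case False
  define c where "c = cinner x y / cinner y y"
  have "cinner (x - c *\<^sub>C y) (c *\<^sub>C y) = 0"
    using False cinner_eq_zero_iff[of y]
    by (simp add: c_def cinner_diff_left cinner_cscale_left cinner_cscale_right)
  then have "(norm (c *\<^sub>C y))\<^sup>2 \<le> (norm x)\<^sup>2"
    using norm_add_orthogonal[of "x - c *\<^sub>C y" "c *\<^sub>C y"] by simp
  then have "norm (c *\<^sub>C y) \<le> norm x"
    by (rule power2_le_imp_le) simp
  moreover have "norm (c *\<^sub>C y) = cmod (cinner x y) / norm y"
    using False by (simp add: norm_cscale c_def cinner_self norm_divide norm_mult power2_eq_square)
  ultimately show ?thesis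
    using False by (simp add: divide_le_eq)
qed simp

lemma bounded_linear_cinner_left: "bounded_linear (\<lambda>x. cinner x y)"
  by (rule bounded_linear_intro[where K = "norm y"])
    (simp_all add: cinner_add_left scaleR_cscale cinner_cscale_left Cauchy_Schwarz_cinner
      scaleR_conv_of_real)

text \<open>The definition of the adjoint picks the operator that satisfies the adjoint identity; it is
  unique because the inner product is nondegenerate.\<close>

lemma op_adjoint_eqI:
  assumes "\<And>x y. cinner (T x) y = cinner x (T' y)"
  shows "op_adjoint T = T'"
  unfolding op_adjoint_def
proof (rule the_equality)
  fix T'' assume "\<forall>x y. cinner (T x) y = cinner x (T'' y)"
  then show "T'' = T'"
    using assms by (metis cinner_eqI_right ext)
qed (simp add: assms)

text \<open>Polarization: the form \<open>(x, y) \<mapsto> cinner (T x) y\<close> takes real values on the diagonal, and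
  expanding it at \<open>x + y\<close> and at \<open>x + \<i> y\<close> shows that it is hermitian.\<close>

lemma op_nonneg_symmetric:
  assumes T: "Vector_Spaces.linear cscale cscale T" and "op_nonneg T"
  shows "cinner (T x) y = cinner x (T y)"
proof -
  have add: "T (u + v) = T u + T v" and scale: "T (c *\<^sub>C u) = c *\<^sub>C T u" for u v c
    using linear.axioms module_hom.add module_hom.scale T
    unfolding linear_iff_module_hom by blast+
  have real: "Im (cinner (T u) u) = 0" for u
    using assms(2) by (simp add: op_nonneg_def complex_nonneg_Reals_iff)
  have "Im (cinner (T x) y + cinner (T y) x) = 0"
    using real[of "x + y"] real[of x] real[of y]
    by (simp add: add cinner_add_left cinner_add_right)
  moreover have "Re (cinner (T x) y) = Re (cinner (T y) x)"
    using real[of "x + \<i> *\<^sub>C y"] real[of x] real[of y]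
    by (simp add: add scale cinner_add_left cinner_add_right cinner_cscale_left
        cinner_cscale_right)
  ultimately have "cinner (T x) y = cnj (cinner (T y) x)"
    by (simp add: complex_eq_iff)
  then show ?thesis
    using cinner_commute[of x "T y"] by simp
qed

section \<open>Orthonormal sets\<close>

text \<open>The Fourier partial sum over a finite orthonormal set is the orthogonal projection onto its
  span.\<close>

lemma fourier_sum_in_span: "(\<Sum>e\<in>F. cinner x e *\<^sub>C e) \<in> complex_vector.span F"
  by (intro complex_vector.span_sum complex_vector.span_scale complex_vector.span_base)

lemma fourier_remainder_orthogonal:
  assumes F: "finite F" "orthonormal_set F" and z: "z \<in> complex_vector.span F"
  shows "cinner (x - (\<Sum>e\<in>F. cinner x e *\<^sub>C e)) z = 0"
  using z
proof (induction rule: complex_vector.span_induct_alt)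
  case (step c f z)
  have "cinner (\<Sum>e\<in>F. cinner x e *\<^sub>C e) f = (\<Sum>e\<in>F. if e = f then cinner x f else 0)"
    using F(2) step(1) unfolding cinner_sum_left orthonormal_set_def
    by (intro sum.cong) (auto simp: cinner_cscale_left)
  also have "\<dots> = cinner x f"
    using F(1) step(1) by simp
  finally show ?case
    using step(2) by (simp add: cinner_add_right cinner_cscale_right cinner_diff_left)
qed simp

lemma orth_proj_eqI:
  assumes S: "complex_vector.subspace S" and "y \<in> S" and "\<And>z. z \<in> S \<Longrightarrow> cinner (x - y) z = 0"
  shows "orth_proj S x = y"
  unfolding orth_proj_def
proof (rule the_equality)
  fix y' assume y': "y' \<in> S \<and> (\<forall>z\<in>S. cinner (x - y') z = 0)"
  then have "y' - y \<in> S"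
    using assms by (intro complex_vector.subspace_diff) auto
  then have "cinner (y' - y) (y' - y) = cinner (x - y) (y' - y) - cinner (x - y') (y' - y)"
    by (simp add: cinner_diff_left)
  also have "\<dots> = 0"
    using y' assms(3) \<open>y' - y \<in> S\<close> by simp
  finally show "y' = y"
    using cinner_eq_zero_iff[of "y' - y"] by simp
qed (use assms in blast)

lemma orth_proj_span:
  assumes "finite F" "orthonormal_set F"
  shows "orth_proj (complex_vector.span F) x = (\<Sum>e\<in>F. cinner x e *\<^sub>C e)"
  by (rule orth_proj_eqI)
    (simp_all add: fourier_sum_in_span fourier_remainder_orthogonal assms)

lemma fourier_sum_best_approximation:
  assumes "finite F" "orthonormal_set F" "z \<in> complex_vector.span F"
  shows "norm (x - (\<Sum>e\<in>F. cinner x e *\<^sub>C e)) \<le> norm (x - z)"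
proof -
  let ?p = "\<Sum>e\<in>F. cinner x e *\<^sub>C e"
  have "cinner (x - ?p) (?p - z) = 0"
    by (rule fourier_remainder_orthogonal)
      (simp_all add: assms complex_vector.span_diff fourier_sum_in_span)
  from norm_add_orthogonal[OF this] have "(norm (x - ?p))\<^sup>2 \<le> (norm (x - z))\<^sup>2"
    by simp
  then show ?thesis
    by (rule power2_le_imp_le) simp
qed

text \<open>A vector of the span that is close to \<open>x\<close> involves finitely many basis vectors; by best
  approximation, every Fourier partial sum over more basis vectors is at least as close.\<close>

lemma hilbert_basis_expansion:
  assumes "hilbert_basis B"
  shows "((\<lambda>e. cinner x e *\<^sub>C e) has_sum x) B"
  unfolding has_sum_def tendsto_iff eventually_finite_subsets_at_top
proof (intro allI impI)
  fix \<epsilon> :: real assume "\<epsilon> > 0"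
  have B: "orthonormal_set B" and "x \<in> closure (complex_vector.span B)"
    using assms by (simp_all add: hilbert_basis_def)
  then obtain z where z: "z \<in> complex_vector.span B" "dist z x < \<epsilon>"
    using \<open>\<epsilon> > 0\<close> unfolding closure_approachable by blast
  obtain F where F: "finite F" "F \<subseteq> B" "z \<in> complex_vector.span F"
    using z(1) by (auto simp: complex_vector.span_explicit)
  show "\<exists>F. finite F \<and> F \<subseteq> B \<and>
      (\<forall>F'. finite F' \<and> F \<subseteq> F' \<and> F' \<subseteq> B \<longrightarrow> dist (\<Sum>e\<in>F'. cinner x e *\<^sub>C e) x < \<epsilon>)"
  proof (intro exI[of _ F] conjI allI impI)
    fix F' assume F': "finite F' \<and> F \<subseteq> F' \<and> F' \<subseteq> B"
    have "orthonormal_set F'"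
      using B F' unfolding orthonormal_set_def by blast
    moreover have "z \<in> complex_vector.span F'"
      using F(3) F' complex_vector.span_mono by blast
    ultimately have "norm (x - (\<Sum>e\<in>F'. cinner x e *\<^sub>C e)) \<le> norm (x - z)"
      using F' by (intro fourier_sum_best_approximation) auto
    then show "dist (\<Sum>e\<in>F'. cinner x e *\<^sub>C e) x < \<epsilon>"
      using z(2) by (simp add: dist_norm norm_minus_commute)
  qed (use F in auto)
qed

lemma parseval:
  assumes "hilbert_basis B"
  shows "((\<lambda>e. cinner x e * cinner e y) has_sum cinner x y) B"
  using has_sum_bounded_linear[OF bounded_linear_cinner_left hilbert_basis_expansion[OF assms]]
  by (simp add: cinner_cscale_left)

text \<open>One step of the Gram--Schmidt process.\<close>

lemma orthonormal_set_extend: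
  assumes "finite F" "orthonormal_set F"
  obtains G where "finite G" "orthonormal_set G" "F \<subseteq> G" "x \<in> complex_vector.span G"
proof (cases "x \<in> complex_vector.span F")
  case False
  let ?p = "\<Sum>e\<in>F. cinner x e *\<^sub>C e"
  define u where "u = x - ?p"
  define v where "v = complex_of_real (1 / norm u) *\<^sub>C u"
  have u: "u \<noteq> 0"
    using False fourier_sum_in_span[of x F] by (auto simp: u_def)
  have "cinner u e = 0" if "e \<in> F" for e
    using fourier_remainder_orthogonal[OF assms] complex_vector.span_base[OF that]
    by (simp add: u_def)
  then have v: "cinner v e = 0" "cinner e v = 0" if "e \<in> F" for e
    using that cinner_commute[of e u]
    by (simp_all add: v_def cinner_cscale_left cinner_cscale_right)
  have "cinner v v = 1"
    using u by (simp add: cinner_self v_def norm_cscale norm_divide)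
  then have "orthonormal_set (insert v F)"
    using assms(2) v unfolding orthonormal_set_def by fastforce
  moreover have "x \<in> complex_vector.span (insert v F)"
  proof -
    have "x = ?p + complex_of_real (norm u) *\<^sub>C v"
      using u by (simp add: v_def cscale_cscale cscale_one) (simp add: u_def)
    moreover have "?p \<in> complex_vector.span (insert v F)"
      using fourier_sum_in_span complex_vector.span_mono[of F "insert v F"] by blast
    ultimately show ?thesis
      by (metis complex_vector.span_add complex_vector.span_base complex_vector.span_scale insertI1)
  qed
  ultimately show thesis
    using that[of "insert v F"] assms by blast
qed (use assms that in blast)

text \<open>The trace is defined by means of some orthonormal basis, so it is meaningful only if there is
  one.  The Gram--Schmidt process, applied to a dense sequence, produces a basis.\<close>

lemma hilbert_basis_exists:
  assumes "\<exists>D::'a::complex_inner set. countable D \<and> closure D = UNIV"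
  shows "\<exists>B::'a set. hilbert_basis B"
proof -
  obtain D :: "'a set" where D: "countable D" "closure D = UNIV"
    using assms by blast
  then have "D \<noteq> {}"
    by auto
  define d where "d = from_nat_into D"
  define P where "P F \<longleftrightarrow> finite F \<and> orthonormal_set F" for F :: "'a set"
  have "\<exists>f. \<forall>n. P (f n) \<and> (f n \<subseteq> f (Suc n) \<and> d n \<in> complex_vector.span (f (Suc n)))"
  proof (rule dependent_nat_choice)
    show "\<exists>F. P F"
      by (rule exI[of _ "{}"]) (simp add: P_def orthonormal_set_def)
    show "\<exists>G. P G \<and> (F \<subseteq> G \<and> d n \<in> complex_vector.span G)" if "P F" for F n
      using that orthonormal_set_extend[of F "d n"] unfolding P_def by metis
  qed
  then obtain f where f: "\<And>n. P (f n)" "\<And>n. f n \<subseteq> f (Suc n)"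
      "\<And>n. d n \<in> complex_vector.span (f (Suc n))"
    by blast
  define B where "B = (\<Union>n. f n)"
  have mono: "f m \<subseteq> f n" if "m \<le> n" for m n
    using that f(2) by (rule lift_Suc_mono_le[rotated])
  have "orthonormal_set B"
    unfolding orthonormal_set_def
  proof (intro ballI)
    fix e e' assume "e \<in> B" "e' \<in> B"
    then obtain m n where "e \<in> f m" "e' \<in> f n"
      by (auto simp: B_def)
    then have "e \<in> f (max m n)" "e' \<in> f (max m n)"
      using mono[of m "max m n"] mono[of n "max m n"] by auto
    then show "cinner e e' = (if e = e' then 1 else 0)"
      using f(1)[of "max m n"] unfolding P_def orthonormal_set_def by blast
  qed
  moreover have "D \<subseteq> complex_vector.span B"
  proof
    fix x assume "x \<in> D"
    then obtain n where "x = d n"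
      using from_nat_into_surj[OF D(1)] unfolding d_def by metis
    moreover have "complex_vector.span (f (Suc n)) \<subseteq> complex_vector.span B"
      by (intro complex_vector.span_mono) (auto simp: B_def)
    ultimately show "x \<in> complex_vector.span B"
      using f(3)[of n] by blast
  qed
  then have "closure (complex_vector.span B) = UNIV"
    using D(2) closure_mono by blast
  ultimately show ?thesis
    unfolding hilbert_basis_def by blast
qed

section \<open>Matrices as operators on the span of an orthonormal family\<close>

lemma mat_adjoint_dim [simp]: "dim_row (mat_adjoint A) = dim_col A" "dim_col (mat_adjoint A) = dim_row A"
  by (simp_all add: mat_adjoint_def)

lemma mat_adjoint_carrier [simp]: "A \<in> carrier_mat n m \<Longrightarrow> mat_adjoint A \<in> carrier_mat m n"
  by (metis carrier_matD carrier_matI mat_adjoint_dim)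

lemma mat_adjoint_index:
  assumes "i < dim_col A" "j < dim_row A"
  shows "mat_adjoint A $$ (i, j) = conjugate (A $$ (j, i))"
  using assms by (simp add: mat_adjoint_def mat_of_rows_index)

lemma cscalar_prod_mat_adjoint:
  fixes A :: "complex mat"
  assumes A: "A \<in> carrier_mat n n" and v: "v \<in> carrier_vec n" and w: "w \<in> carrier_vec n"
  shows "(A *\<^sub>v v) \<bullet>c w = v \<bullet>c (mat_adjoint A *\<^sub>v w)"
proof -
  have "(A *\<^sub>v v) \<bullet>c w = (\<Sum>i<n. \<Sum>j<n. A $$ (i, j) * vec_index v j * cnj (vec_index w i))"
    using assms by (simp add: scalar_prod_def sum_distrib_right lessThan_atLeast0)
  also have "\<dots> = (\<Sum>j<n. \<Sum>i<n. A $$ (i, j) * vec_index v j * cnj (vec_index w i))"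
    by (rule sum.swap)
  also have "\<dots> = v \<bullet>c (mat_adjoint A *\<^sub>v w)"
    using assms by (simp add: scalar_prod_def sum_distrib_left lessThan_atLeast0 mat_adjoint_index
        mult_ac)
  finally show ?thesis .
qed

lemma additive_mat_sum:
  fixes h :: "complex mat \<Rightarrow> 'b::ab_group_add"
  assumes add: "\<And>A B. A \<in> carrier_mat r r \<Longrightarrow> B \<in> carrier_mat r r \<Longrightarrow> h (A + B) = h A + h B"
    and "finite L" and M: "\<And>l. l \<in> L \<Longrightarrow> M l \<in> carrier_mat r r"
  shows "h (mat r r (\<lambda>ab. \<Sum>l\<in>L. M l $$ ab)) = (\<Sum>l\<in>L. h (M l))"
  using assms(2) M
proof (induction L rule: finite_induct)
  case empty
  have "mat r r (\<lambda>ab. 0) = (0\<^sub>m r r :: complex mat)"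
    by (rule eq_matI) auto
  moreover have "h (0\<^sub>m r r) = 0"
    using add[of "0\<^sub>m r r" "0\<^sub>m r r"] by simp
  ultimately show ?case
    by simp
next
  case (insert l L)
  have "mat r r (\<lambda>ab. \<Sum>l\<in>insert l L. M l $$ ab) = M l + mat r r (\<lambda>ab. \<Sum>l\<in>L. M l $$ ab)"
    using insert by (intro eq_matI) auto
  then show ?case
    using insert by (simp add: add)
qed

lemma E_mat_carrier [simp]: "E_mat r k j \<in> carrier_mat r r"
  by (simp add: E_mat_def)

text \<open>The matrices \<open>W\<close> and the identity span all matrices.  Off the diagonal, \<open>W\<close> at \<open>(k, j)\<close> and
  at \<open>(j, k)\<close> are up to scalars the sum and the difference of two matrix units.  On the diagonal,
  let \<open>F j\<close> be the sum of the images of the first \<open>j\<close> diagonal units. Then \<open>F r\<close> is the image of the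
  identity, and the vanishing at \<open>W\<close> with index \<open>(j, j)\<close> says that \<open>F (j + 1)\<close> is \<open>1 + 1/j\<close> times
  \<open>F j\<close>, so all \<open>F j\<close> vanish by descent from \<open>r\<close>.\<close>

lemma linear_vanishes_if_vanishes_on_W:
  fixes h :: "complex mat \<Rightarrow> 'b::complex_inner"
  assumes add: "\<And>A B. A \<in> carrier_mat r r \<Longrightarrow> B \<in> carrier_mat r r \<Longrightarrow> h (A + B) = h A + h B"
    and smult: "\<And>c A. A \<in> carrier_mat r r \<Longrightarrow> h (c \<cdot>\<^sub>m A) = c *\<^sub>C h A"
    and W: "\<And>k j. (k, j) \<in> J_index r \<Longrightarrow> h (W_mat r k j) = 0"
    and one: "h (1\<^sub>m r) = 0"
    and A: "A \<in> carrier_mat r r"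
  shows "h A = 0"
proof -
  have diff: "h (A - B) = h A - h B" if "A \<in> carrier_mat r r" "B \<in> carrier_mat r r" for A B
  proof -
    have "(A - B) + B = A"
      using that by (intro eq_matI) auto
    then have "h A = h (A - B) + h B"
      using add[OF minus_carrier_mat[OF that(2), of A] that(2)] by simp
    then show ?thesis
      by simp
  qed
  have off_diagonal: "h (E_mat r k j) = 0 \<and> h (E_mat r j k) = 0"
    if "k < j" "k \<in> {1..r}" "j \<in> {1..r}" for k j
  proof -
    have "h (W_mat r k j) = 0" "h (W_mat r j k) = 0"
      using that by (auto intro!: W simp: J_index_def)
    then have sum: "h (E_mat r k j) + h (E_mat r j k) = 0"
      and eq: "h (E_mat r j k) = h (E_mat r k j)"
      using that(1) by (simp_all add: minus_carrier_mat W_mat_def smult add diff)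
    have "2 *\<^sub>C h (E_mat r k j) = 0"
      using sum unfolding eq by (simp add: cscale_add_left[of 1 1, simplified] cscale_one)
    then show ?thesis
      using eq by simp
  qed
  define F where "F j = (\<Sum>l=1..j. h (E_mat r l l))" for j
  have "1\<^sub>m r = mat r r (\<lambda>ab. \<Sum>l=1..r. E_mat r l l $$ ab)"
  proof (rule eq_matI)
    fix a b assume "a < dim_row (mat r r (\<lambda>ab. \<Sum>l=1..r. E_mat r l l $$ ab))"
      "b < dim_col (mat r r (\<lambda>ab. \<Sum>l=1..r. E_mat r l l $$ ab))"
    then have ab: "a < r" "b < r"
      by auto
    have "(\<Sum>l=1..r. E_mat r l l $$ (a, b)) = (\<Sum>l=1..r. if l = Suc a then (if a = b then 1 else 0) else 0)"
      using ab by (intro sum.cong) (auto simp: E_mat_def)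
    also have "\<dots> = (if a = b then 1 else 0)"
      using ab by simp
    finally show "1\<^sub>m r $$ (a, b) = mat r r (\<lambda>ab. \<Sum>l=1..r. E_mat r l l $$ ab) $$ (a, b)"
      using ab by simp
  qed auto
  then have F_r: "F r = 0"
    using one by (simp add: F_def additive_mat_sum[OF add, where M = "\<lambda>l. E_mat r l l"])
  have W_diagonal: "h (E_mat r (Suc j) (Suc j)) = complex_of_real (1 / real j) *\<^sub>C F j"
    if "1 \<le> j" "j < r" for j
  proof -
    have "h (W_mat r j j) = 0"
      using that by (intro W) (auto simp: J_index_def)
    moreover have "sqrt (1 + 1 / real j) \<noteq> 0"
      using that by (simp add: add_nonneg_eq_0_iff)
    ultimately have "h (mat r r (\<lambda>ab. \<Sum>l=1..j. (complex_of_real (1 / real j) \<cdot>\<^sub>m E_mat r l l) $$ ab)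
            - E_mat r (j + 1) (j + 1)) = 0"
      by (simp add: minus_carrier_mat W_mat_def smult del: of_real_divide)
    then show ?thesis
      by (simp add: diff smult F_def complex_vector.scale_sum_right
          additive_mat_sum[OF add, where M = "\<lambda>l. complex_of_real (1 / real j) \<cdot>\<^sub>m E_mat r l l"]
          del: of_real_divide)
  qed
  have F: "F j = 0" if "1 \<le> j" "j \<le> r" for j
    using that(2,1)
  proof (induction rule: inc_induct)
    case (step j)
    have "complex_of_real (1 + 1 / real j) *\<^sub>C F j = F j + h (E_mat r (Suc j) (Suc j))"
      using W_diagonal[of j] step by (simp add: cscale_add_left cscale_one)
    moreover have "F (Suc j) = F j + h (E_mat r (Suc j) (Suc j))"
      by (simp add: F_def)
    moreover have "1 + 1 / real j > 0"
      by (simp add: add_pos_nonneg)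
    then have nonzero: "complex_of_real (1 + 1 / real j) \<noteq> 0"
      unfolding of_real_eq_0_iff by linarith
    moreover have "F (Suc j) = 0"
      using step.IH by simp
    ultimately have "complex_of_real (1 + 1 / real j) *\<^sub>C F j = 0"
      by simp
    then show ?case
      using nonzero by (simp only: complex_vector.scale_eq_0_iff simp_thms)
  next
    case base
    then show ?case
      by (simp only: F_r)
  qed
  have diagonal: "h (E_mat r (Suc a) (Suc a)) = 0" if "a < r" for a
    using F[of "Suc a"] F[of a] that by (cases a) (simp_all add: F_def)
  have E: "h (E_mat r (Suc a) (Suc b)) = 0" if "a < r" "b < r" for a b
    using off_diagonal[of "Suc a" "Suc b"] off_diagonal[of "Suc b" "Suc a"] diagonal[of a] that
    by (cases a b rule: linorder_cases) auto
  let ?M = "\<lambda>p. A $$ p \<cdot>\<^sub>m E_mat r (Suc (fst p)) (Suc (snd p))"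
  have "A = mat r r (\<lambda>ab. \<Sum>p\<in>{..<r} \<times> {..<r}. ?M p $$ ab)"
  proof (rule eq_matI)
    fix a b assume "a < dim_row (mat r r (\<lambda>ab. \<Sum>p\<in>{..<r} \<times> {..<r}. ?M p $$ ab))"
      "b < dim_col (mat r r (\<lambda>ab. \<Sum>p\<in>{..<r} \<times> {..<r}. ?M p $$ ab))"
    then have ab: "a < r" "b < r"
      by auto
    have "(\<Sum>p\<in>{..<r} \<times> {..<r}. ?M p $$ (a, b)) =
        (\<Sum>p\<in>{..<r} \<times> {..<r}. if p = (a, b) then A $$ (a, b) else 0)"
      using ab by (intro sum.cong) (auto simp: E_mat_def)
    also have "\<dots> = A $$ (a, b)"
      using ab by simp
    finally show "A $$ (a, b) = mat r r (\<lambda>ab. \<Sum>p\<in>{..<r} \<times> {..<r}. ?M p $$ ab) $$ (a, b)"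
      using ab by simp
  qed (use A in auto)
  then have "h A = h (mat r r (\<lambda>ab. \<Sum>p\<in>{..<r} \<times> {..<r}. ?M p $$ ab))"
    by (rule arg_cong)
  also have "\<dots> = (\<Sum>p\<in>{..<r} \<times> {..<r}. h (?M p))"
    by (rule additive_mat_sum) (simp_all add: add)
  also have "\<dots> = 0"
    using E by (intro sum.neutral) (auto simp: smult)
  finally show ?thesis .
qed

text \<open>An orthonormal family of \<open>r\<close> vectors amounts to an isometry \<open>synth\<close> from \<open>\<complex>\<^sup>r\<close> into the
  Hilbert space, with adjoint \<open>coord\<close>.  Conjugation of a matrix by this isometry is the map
  \<open>op_of_mat\<close>.  The index shift reconciles vectors numbered from \<open>1\<close> with coordinates numbered
  from \<open>0\<close>.\<close>

locale orthonormal_family =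
  fixes r :: nat and s :: "nat \<Rightarrow> 'h::complex_inner"
  assumes orthonormal: "\<forall>k\<in>{1..r}. \<forall>j\<in>{1..r}. cinner (s k) (s j) = (if k = j then 1 else 0)"
begin

definition coord :: "'h \<Rightarrow> complex vec" where
  "coord x = vec r (\<lambda>a. cinner x (s (Suc a)))"

definition synth :: "complex vec \<Rightarrow> 'h" where
  "synth v = (\<Sum>a<r. vec_index v a *\<^sub>C s (Suc a))"

definition op_of_mat :: "complex mat \<Rightarrow> 'h \<Rightarrow> 'h" where
  "op_of_mat A x = synth (A *\<^sub>v coord x)"

lemma coord_carrier [simp]: "coord x \<in> carrier_vec r"
  by (simp add: coord_def)

lemma cinner_s: "a < r \<Longrightarrow> b < r \<Longrightarrow> cinner (s (Suc a)) (s (Suc b)) = (if a = b then 1 else 0)"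
  using orthonormal by auto

lemma cinner_synth_left: "cinner (synth v) y = v \<bullet>c coord y"
  by (simp add: synth_def cinner_sum_left cinner_cscale_left scalar_prod_def coord_def
      lessThan_atLeast0 cinner_commute[of y])

lemma coord_synth:
  assumes "v \<in> carrier_vec r"
  shows "coord (synth v) = v"
proof (rule eq_vecI)
  fix b assume "b < dim_vec v"
  then have b: "b < r"
    using assms by simp
  have "vec_index (coord (synth v)) b = (\<Sum>a<r. vec_index v a * cinner (s (Suc a)) (s (Suc b)))"
    using b by (simp add: coord_def synth_def cinner_sum_left cinner_cscale_left)
  also have "\<dots> = (\<Sum>a<r. if a = b then vec_index v b else 0)"
    using b by (intro sum.cong) (auto simp: cinner_s)
  also have "\<dots> = vec_index v b"
    using b by simp
  finally show "vec_index (coord (synth v)) b = vec_index v b" .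
qed (use assms in \<open>simp add: coord_def\<close>)

lemma orthonormal_set_s: "orthonormal_set (s ` {1..r})" and inj_on_s: "inj_on s {1..r}"
proof -
  show "inj_on s {1..r}"
    using orthonormal by (metis inj_onI zero_neq_one)
  then show "orthonormal_set (s ` {1..r})"
    using orthonormal unfolding orthonormal_set_def by (auto simp: inj_on_eq_iff)
qed

lemma synth_coord: "synth (coord x) = orth_proj (complex_vector.span (s ` {1..r})) x"
proof -
  have "orth_proj (complex_vector.span (s ` {1..r})) x = (\<Sum>k=1..r. cinner x (s k) *\<^sub>C s k)"
    unfolding orth_proj_span[OF finite_imageI[OF finite_atLeastAtMost] orthonormal_set_s]
      sum.reindex[OF inj_on_s] by simp
  also have "\<dots> = synth (coord x)"
    by (simp add: synth_def coord_def sum.atLeast1_atMost_eq)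
  finally show ?thesis ..
qed

lemma op_of_mat_one: "op_of_mat (1\<^sub>m r) = orth_proj (complex_vector.span (s ` {1..r}))"
  by (simp add: op_of_mat_def synth_coord fun_eq_iff)

text \<open>The factor \<open>coord \<circ> synth\<close> between the two matrices is the identity of \<open>\<complex>\<^sup>r\<close>.\<close>

lemma op_of_mat_mult:
  assumes "A \<in> carrier_mat r r" "B \<in> carrier_mat r r"
  shows "op_of_mat (A * B) = op_of_mat A \<circ> op_of_mat B"
  using assms by (simp add: op_of_mat_def fun_eq_iff coord_synth assoc_mult_mat_vec[of _ r r _ r])

lemma op_of_mat_expand:
  assumes "A \<in> carrier_mat r r"
  shows "op_of_mat A x = (\<Sum>a<r. (\<Sum>b<r. A $$ (a, b) * cinner x (s (Suc b))) *\<^sub>C s (Suc a))"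
  using assms
  by (simp add: op_of_mat_def synth_def scalar_prod_def coord_def lessThan_atLeast0)

lemma op_of_mat_add:
  assumes "A \<in> carrier_mat r r" "B \<in> carrier_mat r r"
  shows "op_of_mat (A + B) x = op_of_mat A x + op_of_mat B x"
  using assms
  by (simp add: op_of_mat_expand sum.distrib cscale_add_left distrib_right)

lemma op_of_mat_smult:
  assumes "A \<in> carrier_mat r r"
  shows "op_of_mat (c \<cdot>\<^sub>m A) x = c *\<^sub>C op_of_mat A x"
  using assms
  by (simp add: op_of_mat_expand complex_vector.scale_sum_right cscale_cscale sum_distrib_left
      mult.assoc)

lemma op_of_mat_diff:
  assumes "A \<in> carrier_mat r r" "B \<in> carrier_mat r r"
  shows "op_of_mat (A - B) x = op_of_mat A x - op_of_mat B x"
  using assms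
  by (simp add: minus_carrier_mat op_of_mat_expand sum_subtractf
      complex_vector.scale_left_diff_distrib left_diff_distrib)

lemma op_of_mat_E:
  assumes "k \<in> {1..r}" "j \<in> {1..r}"
  shows "op_of_mat (E_mat r k j) x = rank_one (s k) (s j) x"
proof -
  have kj: "k - 1 < r" "j - 1 < r"
    using assms by auto
  have "op_of_mat (E_mat r k j) x =
      (\<Sum>a<r. if a = k - 1 then cinner x (s j) *\<^sub>C s k else 0)"
    unfolding op_of_mat_expand[OF E_mat_carrier]
  proof (intro sum.cong refl)
    fix a assume a: "a \<in> {..<r}"
    have "(\<Sum>b<r. E_mat r k j $$ (a, b) * cinner x (s (Suc b))) =
        (\<Sum>b<r. if b = j - 1 then if a = k - 1 then cinner x (s j) else 0 else 0)"
      using a assms by (intro sum.cong) (auto simp: E_mat_def)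
    also have "\<dots> = (if a = k - 1 then cinner x (s j) else 0)"
      using kj by simp
    finally show "(\<Sum>b<r. E_mat r k j $$ (a, b) * cinner x (s (Suc b))) *\<^sub>C s (Suc a) =
        (if a = k - 1 then cinner x (s j) *\<^sub>C s k else 0)"
      using assms by auto
  qed
  also have "\<dots> = rank_one (s k) (s j) x"
    using kj by (simp add: rank_one_def)
  finally show ?thesis .
qed

text \<open>\<open>W_mat\<close> and \<open>V_op\<close> are the same linear combinations, of matrix units and of the corresponding
  rank one operators.\<close>

lemma op_of_mat_W:
  assumes "(k, j) \<in> J_index r"
  shows "op_of_mat (W_mat r k j) x = V_op s k j x"
proof (cases "k = j")
  case True
  then have j: "1 \<le> j" "j < r"
    using assms by (auto simp: J_index_def)
  have "op_of_mat (mat r r (\<lambda>ab. \<Sum>l=1..j. (complex_of_real (1 / real j) \<cdot>\<^sub>m E_mat r l l) $$ ab)) x =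
      (\<Sum>l=1..j. op_of_mat (complex_of_real (1 / real j) \<cdot>\<^sub>m E_mat r l l) x)"
    by (rule additive_mat_sum) (simp_all add: op_of_mat_add)
  also have "\<dots> = (\<Sum>l=1..j. complex_of_real (1 / real j) *\<^sub>C rank_one (s l) (s l) x)"
    using j by (intro sum.cong) (simp_all add: op_of_mat_smult op_of_mat_E)
  finally show ?thesis
    using True j
    by (simp add: W_mat_def V_op_def minus_carrier_mat op_of_mat_smult op_of_mat_diff
        op_of_mat_E del: of_real_divide)
next
  case False
  then show ?thesis
    using assms
    by (auto simp: J_index_def W_mat_def V_op_def minus_carrier_mat op_of_mat_smult
        op_of_mat_diff op_of_mat_add op_of_mat_E)
qed

lemma cinner_op_of_mat:
  assumes "A \<in> carrier_mat r r"
  shows "cinner (op_of_mat A x) y = (A *\<^sub>v coord x) \<bullet>c coord y"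
  by (simp add: op_of_mat_def cinner_synth_left)

lemma op_adjoint_op_of_mat:
  assumes A: "A \<in> carrier_mat r r"
  shows "op_adjoint (op_of_mat A) = op_of_mat (mat_adjoint A)"
proof (rule op_adjoint_eqI)
  fix x y
  have w: "mat_adjoint A *\<^sub>v coord y \<in> carrier_vec r"
    using A by (intro mult_mat_vec_carrier[of _ r r]) simp_all
  have cnj: "cnj (w \<bullet>c coord x) = coord x \<bullet>c w" if "w \<in> carrier_vec r" for w
    using that by (simp add: scalar_prod_def coord_def mult.commute)
  have "cinner x (op_of_mat (mat_adjoint A) y) = cnj ((mat_adjoint A *\<^sub>v coord y) \<bullet>c coord x)"
    unfolding op_of_mat_def cinner_synth_left[symmetric] by (rule cinner_commute)
  also have "\<dots> = coord x \<bullet>c (mat_adjoint A *\<^sub>v coord y)"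
    using w by (rule cnj)
  also have "\<dots> = cinner (op_of_mat A x) y"
    using A by (simp add: cinner_op_of_mat cscalar_prod_mat_adjoint[of _ r])
  finally show "cinner (op_of_mat A x) y = cinner x (op_of_mat (mat_adjoint A) y)" ..
qed

text \<open>Every vector of \<open>\<complex>\<^sup>r\<close> occurs as \<open>coord x\<close>, so the two quadratic forms take the same values.\<close>

lemma op_nonneg_op_of_mat_iff:
  assumes A: "A \<in> carrier_mat r r"
  shows "op_nonneg (op_of_mat A) \<longleftrightarrow> mat_nonneg A"
proof -
  have "range coord = carrier_vec r"
  proof
    show "carrier_vec r \<subseteq> range coord"
      using coord_synth by (metis rangeI subsetI)
  qed (use coord_carrier in blast)
  then have "(\<forall>x. (A *\<^sub>v coord x) \<bullet>c coord x \<in> \<real>\<^sub>\<ge>\<^sub>0) \<longleftrightarrow>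
      (\<forall>v\<in>carrier_vec r. (A *\<^sub>v v) \<bullet>c v \<in> \<real>\<^sub>\<ge>\<^sub>0)"
    by (metis (no_types, lifting) imageE rangeI)
  then show ?thesis
    using A by (simp add: op_nonneg_def mat_nonneg_def cinner_op_of_mat)
qed

lemma op_of_mat_bounded_ops:
  assumes A: "A \<in> carrier_mat r r"
  shows "op_of_mat A \<in> bounded_ops"
proof -
  have "bounded_linear (\<lambda>x. (\<Sum>b<r. A $$ (a, b) * cinner x (s (Suc b))) *\<^sub>C s (Suc a))" for a
  proof -
    have f: "bounded_linear (\<lambda>x. \<Sum>b<r. A $$ (a, b) * cinner x (s (Suc b)))" (is "bounded_linear ?f")
      by (intro bounded_linear_sum bounded_linear_const_mult bounded_linear_cinner_left)
    moreover have "bounded_linear (\<lambda>c. c *\<^sub>C s (Suc a))"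
      by (rule bounded_linear_intro[where K = "norm (s (Suc a))"])
        (simp_all add: cscale_add_left scaleR_cscale cscale_cscale norm_cscale scaleR_conv_of_real)
    ultimately show ?thesis
      by (rule bounded_linear_compose[rotated])
  qed
  then have "bounded_linear (op_of_mat A)"
    unfolding op_of_mat_expand[OF A, abs_def] by (intro bounded_linear_sum) auto
  moreover have "Vector_Spaces.linear cscale cscale (op_of_mat A)"
    using A unfolding Vector_Spaces.linear_iff
    by (simp add: complex_vector.vector_space_axioms op_of_mat_expand cinner_add_left
        cinner_cscale_left distrib_left sum.distrib cscale_add_left
        complex_vector.scale_sum_right cscale_cscale sum_distrib_left mult.left_commute)
  ultimately show ?thesis
    by (simp add: bounded_ops_def)
qed

text \<open>By Parseval, the trace of the rank one operator with the vectors \<open>s\<^sub>a\<close> and \<open>s\<^sub>b\<close> is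
  \<open>cinner s\<^sub>a s\<^sub>b\<close> in every orthonormal basis.\<close>

lemma op_of_mat_diagonal_has_sum:
  assumes A: "A \<in> carrier_mat r r" and B: "hilbert_basis B"
  shows "((\<lambda>e. cinner (op_of_mat A e) e) has_sum mat_trace A) B"
proof -
  have has_sum_sum: "((\<lambda>e. \<Sum>i\<in>I. f i e) has_sum (\<Sum>i\<in>I. t i)) B"
    if "finite I" "\<And>i. i \<in> I \<Longrightarrow> (f i has_sum t i) B" for I :: "nat set" and f and t :: "nat \<Rightarrow> complex"
    using that by (induction I rule: finite_induct) (auto intro: has_sum_add)
  have "((\<lambda>e. \<Sum>a<r. \<Sum>b<r. A $$ (a, b) * (cinner (s (Suc a)) e * cinner e (s (Suc b)))) has_sum
      (\<Sum>a<r. \<Sum>b<r. A $$ (a, b) * cinner (s (Suc a)) (s (Suc b)))) B"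
    by (intro has_sum_sum has_sum_cmult_right parseval B) simp_all
  moreover have "cinner (op_of_mat A e) e =
      (\<Sum>a<r. \<Sum>b<r. A $$ (a, b) * (cinner (s (Suc a)) e * cinner e (s (Suc b))))" for e
    by (simp add: op_of_mat_expand[OF A] cinner_sum_left cinner_cscale_left sum_distrib_left
        mult_ac)
  moreover have "(\<Sum>a<r. \<Sum>b<r. A $$ (a, b) * cinner (s (Suc a)) (s (Suc b))) = mat_trace A"
  proof -
    have "(\<Sum>b<r. A $$ (a, b) * cinner (s (Suc a)) (s (Suc b))) = A $$ (a, a)" if "a < r" for a
    proof -
      have "(\<Sum>b<r. A $$ (a, b) * cinner (s (Suc a)) (s (Suc b))) = (\<Sum>b<r. if b = a then A $$ (a, a) else 0)"
        using that by (intro sum.cong) (auto simp: cinner_s)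
      then show ?thesis
        using that by simp
    qed
    then show ?thesis
      using A by (simp add: mat_trace_def)
  qed
  ultimately show ?thesis
    by simp
qed

lemma op_trace_op_of_mat:
  assumes "A \<in> carrier_mat r r" and "\<exists>B::'h set. hilbert_basis B"
  shows "op_trace (op_of_mat A) = mat_trace A"
  unfolding op_trace_def
  by (rule infsumI, rule op_of_mat_diagonal_has_sum[OF assms(1)], rule someI_ex[OF assms(2)])

end

section \<open>Density operators\<close>

lemma op_nonneg_self_adjoint:
  assumes "Y \<in> bounded_ops" "op_nonneg Y"
  shows "op_adjoint Y = Y"
  using assms by (intro op_adjoint_eqI op_nonneg_symmetric) (auto simp: bounded_ops_def)

text \<open>A nonnegative operator is its own modulus.\<close>

lemma op_nonneg_trace_class:
  assumes "Y \<in> bounded_ops" "op_nonneg Y" "hilbert_basis B" "(\<lambda>e. cinner (Y e) e) summable_on B"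
  shows "Y \<in> trace_class"
proof -
  have "Y \<circ> Y = op_adjoint Y \<circ> Y"
    using assms by (simp add: op_nonneg_self_adjoint)
  then show ?thesis
    using assms unfolding trace_class_def by blast
qed

text \<open>Taking adjoints in \<open>P\<^sub>S Y = Y\<close> gives \<open>Y = Y P\<^sub>S\<close>, hence \<open>Y = P\<^sub>S Y P\<^sub>S\<close>.\<close>

lemma op_nonneg_in_corner_algebra:
  assumes F: "finite F" "orthonormal_set F"
    and Y: "Y \<in> bounded_ops" "op_nonneg Y" "orth_proj (complex_vector.span F) \<circ> Y = Y"
  shows "Y \<in> corner_algebra (complex_vector.span F)"
proof -
  let ?P = "orth_proj (complex_vector.span F)"
  have linear: "Vector_Spaces.linear cscale cscale Y"
    using Y(1) by (simp add: bounded_ops_def)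
  have P: "?P x = (\<Sum>e\<in>F. cinner x e *\<^sub>C e)" for x
    by (rule orth_proj_span[OF F])
  have range: "Y y \<in> complex_vector.span F" for y
    using fourier_sum_in_span[of "Y y" F] fun_cong[OF Y(3), of y] by (simp add: P)
  have "Y (?P x) = Y x" for x
  proof (rule cinner_eqI_left)
    fix y
    have "cinner (x - ?P x) (Y y) = 0"
      unfolding P by (rule fourier_remainder_orthogonal[OF F range])
    then show "cinner (Y (?P x)) y = cinner (Y x) y"
      by (simp add: op_nonneg_symmetric[OF linear Y(2)] cinner_diff_left)
  qed
  then have "Y = ?P \<circ> Y \<circ> ?P"
    using Y(3) by (simp add: fun_eq_iff)
  then show ?thesis
    using Y(1) unfolding corner_algebra_def by blast
qed

section \<open>Transfer between matrices and the corner algebra\<close>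

theorem proposition10:
  fixes S :: "'h::complex_hilbert set"
    and s :: "nat \<Rightarrow> 'h"
    and r :: nat
    and U :: "complex mat \<Rightarrow> 'h \<Rightarrow> 'h"
  assumes separable: "\<exists>D::'h set. countable D \<and> closure D = UNIV"
    and infinite_dim: "\<not> (\<exists>F::'h set. finite F \<and> complex_vector.span F = UNIV)"
    and subspace_S: "complex_vector.subspace S"
    and dim_S: "complex_vector.dim S = r"
    and r_pos: "1 \<le> r"
    and s_orthonormal:
      "\<forall>k\<in>{1..r}. \<forall>j\<in>{1..r}. cinner (s k) (s j) = (if k = j then 1 else 0)"
    and s_span: "complex_vector.span (s ` {1..r}) = S"
    and U_bij: "bij_betw U (carrier_mat r r) (corner_algebra S)"
    and U_add: "\<forall>A\<in>carrier_mat r r. \<forall>B\<in>carrier_mat r r. U (A + B) = (\<lambda>x. U A x + U B x)"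
    and U_smult: "\<forall>c. \<forall>A\<in>carrier_mat r r. U (c \<cdot>\<^sub>m A) = (\<lambda>x. c *\<^sub>C U A x)"
    and U_W: "\<forall>(k, j)\<in>J_index r. U (W_mat r k j) = V_op s k j"
    and U_one: "U (1\<^sub>m r) = orth_proj S"
  shows
    "(\<forall>A\<in>carrier_mat r r. \<forall>B\<in>carrier_mat r r.
        op_trace (U A) = mat_trace A
      \<and> op_adjoint (U A) = U (mat_adjoint A)
      \<and> (op_adjoint (U A) = U A \<longleftrightarrow> A = mat_adjoint A)
      \<and> U (A * B) = U A \<circ> U B
      \<and> inv_into (carrier_mat r r) U (U A \<circ> U B) = A * B
      \<and> (invertible_mat A \<longrightarrow>
            (\<exists>T\<in>corner_algebra S. T \<circ> U A = orth_proj S \<and> U A \<circ> T = orth_proj S)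
          \<and> (\<forall>A'. inverts_mat A A' \<and> inverts_mat A' A \<longrightarrow> U A' \<circ> U A = orth_proj S))
      \<and> (mat_nonneg A \<longleftrightarrow> op_nonneg (U A))
      \<and> op_trace (U A \<circ> op_adjoint (U B)) = mat_trace (A * mat_adjoint B))
    \<and> (\<forall>P\<in>carrier_mat r r. mat_projection P \<longleftrightarrow> op_projection (U P))
    \<and> U ` {R \<in> carrier_mat r r. mat_hermitian R \<and> mat_nonneg R \<and> mat_trace R = 1} = density_ops S"
proof -
  interpret orthonormal_family r s
    by unfold_locales (rule s_orthonormal)
  have basis: "\<exists>B::'h set. hilbert_basis B"
    using separable by (rule hilbert_basis_exists)
  have U: "U A = op_of_mat A" if A: "A \<in> carrier_mat r r" for A
  proof
    fix x
    have "U A x - op_of_mat A x = 0"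
    proof (rule linear_vanishes_if_vanishes_on_W[where h = "\<lambda>A. U A x - op_of_mat A x" and r = r])
      show "U (1\<^sub>m r) x - op_of_mat (1\<^sub>m r) x = 0"
        unfolding U_one op_of_mat_one s_span by simp
      show "U (W_mat r k j) x - op_of_mat (W_mat r k j) x = 0" if "(k, j) \<in> J_index r" for k j
        using that U_W by (auto simp: op_of_mat_W)
    qed (use A in \<open>simp_all add: U_add U_smult op_of_mat_add op_of_mat_smult
        complex_vector.scale_right_diff_distrib\<close>)
    then show "U A x = op_of_mat A x"
      by simp
  qed
  \<comment> \<open>From here on everything transfers along \<open>U A = op_of_mat A\<close>; the equivalences also use that
    \<open>U\<close> is injective.\<close>
  have inj: "U A = U B \<longleftrightarrow> A = B" if "A \<in> carrier_mat r r" "B \<in> carrier_mat r r" for A B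
    using inj_on_eq_iff[OF bij_betw_imp_inj_on[OF U_bij]] that by blast
  have mult: "U (A * B) = U A \<circ> U B" if "A \<in> carrier_mat r r" "B \<in> carrier_mat r r" for A B
    using that by (simp add: U op_of_mat_mult)
  have adjoint: "op_adjoint (U A) = U (mat_adjoint A)" if "A \<in> carrier_mat r r" for A
    using that by (simp add: U op_adjoint_op_of_mat)
  have self_adjoint: "op_adjoint (U A) = U A \<longleftrightarrow> mat_adjoint A = A" if "A \<in> carrier_mat r r" for A
    using that by (simp add: adjoint inj)
  have trace: "op_trace (U A) = mat_trace A" if "A \<in> carrier_mat r r" for A
    using that basis by (simp add: U op_trace_op_of_mat)
  have nonneg: "op_nonneg (U A) \<longleftrightarrow> mat_nonneg A" if "A \<in> carrier_mat r r" for A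
    using that by (simp add: U op_nonneg_op_of_mat_iff)
  have bounded: "U A \<in> bounded_ops" if "A \<in> carrier_mat r r" for A
    using that by (simp add: U op_of_mat_bounded_ops)
  have inverse: "A' \<in> carrier_mat r r \<and> U A' \<circ> U A = orth_proj S \<and> U A \<circ> U A' = orth_proj S"
    if A: "A \<in> carrier_mat r r" and inverts: "inverts_mat A A'" "inverts_mat A' A" for A A'
  proof -
    have AA': "A * A' = 1\<^sub>m r" and A'A: "A' * A = 1\<^sub>m (dim_row A')"
      using A inverts by (auto simp: inverts_mat_def)
    \<comment> \<open>The two products fix the size of \<open>A'\<close>, which \<open>inverts_mat\<close> leaves open.\<close>
    have "dim_col A' = r" "dim_row A' = r"
      using arg_cong[OF AA', of dim_col] arg_cong[OF A'A, of dim_col] A by simp_all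
    then have A': "A' \<in> carrier_mat r r"
      by blast
    then show ?thesis
      using A AA' A'A by (simp add: mult[symmetric] U_one)
  qed
  have "U ` {R \<in> carrier_mat r r. mat_hermitian R \<and> mat_nonneg R \<and> mat_trace R = 1} = density_ops S"
    (is "U ` ?D = _")
  proof (intro equalityI subsetI)
    fix Y assume "Y \<in> U ` ?D"
    then obtain R where R: "R \<in> carrier_mat r r" "mat_nonneg R" "mat_trace R = 1" and Y: "Y = U R"
      by blast
    obtain B :: "'h set" where B: "hilbert_basis B"
      using basis by blast
    have "Y \<in> trace_class"
      unfolding Y
    proof (rule op_nonneg_trace_class[OF bounded _ B])
      show "(\<lambda>e. cinner (U R e) e) summable_on B"
        using op_of_mat_diagonal_has_sum[OF R(1) B] by (auto simp: U R summable_on_def)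
    qed (use R in \<open>simp_all add: nonneg\<close>)
    moreover have "orth_proj S \<circ> Y = Y"
      using R(1) mult[of "1\<^sub>m r" R] by (simp add: Y U_one)
    ultimately show "Y \<in> density_ops S"
      using R by (simp add: density_ops_def Y nonneg trace)
  next
    fix Y assume "Y \<in> density_ops S"
    then have Y: "Y \<in> bounded_ops" "op_nonneg Y" "orth_proj S \<circ> Y = Y" "op_trace Y = 1"
      by (simp_all add: density_ops_def trace_class_def)
    then have "Y \<in> corner_algebra S"
      using op_nonneg_in_corner_algebra[OF _ orthonormal_set_s] unfolding s_span by blast
    then obtain R where R: "R \<in> carrier_mat r r" "Y = U R"
      using bij_betw_imp_surj_on[OF U_bij] by blast
    moreover have "mat_hermitian R"
      using op_nonneg_self_adjoint[OF Y(1,2)] R by (simp add: mat_hermitian_def self_adjoint)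
    ultimately show "Y \<in> U ` ?D"
      using Y R nonneg trace by auto
  qed
  moreover have "mat_projection P \<longleftrightarrow> op_projection (U P)" if P: "P \<in> carrier_mat r r" for P
    using P by (simp add: mat_projection_def op_projection_def bounded self_adjoint mult[symmetric] inj)
  moreover have "op_trace (U A \<circ> op_adjoint (U B)) = mat_trace (A * mat_adjoint B)"
    if A: "A \<in> carrier_mat r r" and B: "B \<in> carrier_mat r r" for A B
    using A B mat_adjoint_carrier[OF B]
    by (simp add: adjoint mult[symmetric] trace mult_carrier_mat[of _ r r])
  moreover have "inv_into (carrier_mat r r) U (U A \<circ> U B) = A * B"
    if A: "A \<in> carrier_mat r r" and B: "B \<in> carrier_mat r r" for A B
    using bij_betw_imp_inj_on[OF U_bij] A B by (simp add: mult[symmetric])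
  moreover have "\<exists>T\<in>corner_algebra S. T \<circ> U A = orth_proj S \<and> U A \<circ> T = orth_proj S"
    if A: "A \<in> carrier_mat r r" and invertible: "invertible_mat A" for A
  proof -
    obtain A' where "inverts_mat A A'" "inverts_mat A' A"
      using invertible by (auto simp: invertible_mat_def)
    from inverse[OF A this] show ?thesis
      using bij_betwE[OF U_bij] by blast
  qed
  ultimately show ?thesis
    by (intro conjI ballI impI allI)
      (simp_all add: trace adjoint inj mult nonneg inverse eq_commute[of _ "mat_adjoint _"])
qed

end
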